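(* Consider any instance of the online allocation model with full compatibility and homogeneous bonuses, i.e. $f_i=f$ for all products $i\in\mathcal I$, where $f:\mathbb Z_+\to\mathbb R_+$ is nonnegative and nondecreasing with $f(0)=0$. Let $C=\sum_{i\in\mathcal I}b_i$. Let $\pi^{\mathrm{base}}$ be the fixed-order fill algorithm that orders products in nonincreasing base reward $r_i$, and let $\pi^{\mathrm{cap}}$ be the fixed-order fill algorithm that orders products in nonincreasing capacity $b_i$. Then the one of $\pi^{\mathrm{base}},\pi^{\mathrm{cap}}$ with the larger expected reward can be selected in $O(TC)$ time, and $$\max\left\{\mathbb E\left[\mathrm{Rev}^{\pi^{\mathrm{base}}}\right],\ \mathbb E\left[\mathrm{Rev}^{\pi^{\mathrm{cap}}}\right]\right\}\ \ge\ \frac12\,\mathbb E[U(L)].$$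
   Context: Model. An instance consists of products $\mathcal I=\{1,\dots,m\}$, capacities $b_i\in\mathbb Z_+$ (nonnegative integers), base rewards $r_i\ge 0$, bonus functions $f_i:\mathbb Z_+\to\mathbb R_+$ that are nonnegative and nondecreasing with $f_i(0)=0$, a horizon of $T$ periods and arrival probabilities $p_1,\dots,p_T\in[0,1]$. In period $t$ a customer arrives with probability $p_t$, independently across periods; $L$ is the total number of arrivals. Each arriving customer must be immediately and irrevocably assigned to a product with remaining capacity or rejected; every customer may be assigned to every product (full compatibility). The $k$-th sale of product $i$ yields reward $r_i+f_i(k)$, so $n$ sales yield $R_i(n)=n r_i+\sum_{k=1}^n f_i(k)$, $R_i(0)=0$. An online algorithm $\pi$ (possibly randomized) knows all instance parameters but not future arrivals; $\mathrm{Rev}^\pi$ is its random total reward. Offline benchmark: $U(\ell)=\max\{\sum_{i\in\mathcal I}R_i(x_i): \boldsymbol x\in\mathbb Z_+^m,\ x_i\le b_i\ \forall i,\ \sum_i x_i\le \ell\}$ for $\ell\in\mathbb Z_+$. Fixed-order fill algorithm: given an ordering $\sigma=(\sigma_1,\dots,\sigma_m)$ of the products, each arriving customer is assigned to the first product in the order $\sigma$ that still has remaining capacity; if all products are full the customer is rejected.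
   Formalization: The selection time is proved as O(TC + z + 1), where z is the number of products with b_i = 0 and the two orderings are given as input; literal O(TC) fails when TC = 0 or when many products have capacity 0, and the bound is O(TC) when all b_i ≥ 1 and T, C ≥ 1. *)

theory Defs
  imports "HOL-Probability.Probability"
begin

section \<open>The online allocation model\<close>

text \<open>Products are \<open>0, ..., products I - 1\<close> and periods are \<open>0, ..., horizon I - 1\<close>; values of
  the fields outside these ranges are irrelevant.\<close>

record alloc =
  products :: nat
  capacity :: "nat \<Rightarrow> nat"
  base_reward :: "nat \<Rightarrow> real"
  bonus :: "nat \<Rightarrow> nat \<Rightarrow> real"
  horizon :: nat
  arrival_prob :: "nat \<Rightarrow> real"

definition valid_alloc :: "alloc \<Rightarrow> bool" where
  "valid_alloc I \<longleftrightarrow>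
     (\<forall>i<products I. 0 \<le> base_reward I i \<and>
        (\<forall>k. 0 \<le> bonus I i k) \<and> mono (bonus I i) \<and> bonus I i 0 = 0) \<and>
     (\<forall>t<horizon I. 0 \<le> arrival_prob I t \<and> arrival_prob I t \<le> 1)"

definition homogeneous :: "alloc \<Rightarrow> (nat \<Rightarrow> real) \<Rightarrow> bool" where
  "homogeneous I f \<longleftrightarrow> (\<forall>i<products I. bonus I i = f)"

definition total_capacity :: "alloc \<Rightarrow> nat" where
  "total_capacity I = (\<Sum>i<products I. capacity I i)"

definition reward :: "alloc \<Rightarrow> nat \<Rightarrow> nat \<Rightarrow> real" where
  "reward I i n = real n * base_reward I i + (\<Sum>k=1..n. bonus I i k)"

definition offline :: "alloc \<Rightarrow> nat \<Rightarrow> real" where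
  "offline I l = Max ((\<lambda>x. \<Sum>i<products I. reward I i (x i)) `
     {x \<in> (\<Pi>\<^sub>E i\<in>{..<products I}. {..capacity I i}). (\<Sum>i<products I. x i) \<le> l})"

text \<open>An arrival pattern tells for each period whether a customer arrives.\<close>

definition arrivals :: "alloc \<Rightarrow> (nat \<Rightarrow> bool) pmf" where
  "arrivals I = Pi_pmf {..<horizon I} False (\<lambda>t. bernoulli_pmf (arrival_prob I t))"

definition num_arrivals :: "alloc \<Rightarrow> (nat \<Rightarrow> bool) \<Rightarrow> nat" where
  "num_arrivals I a = card {t. t < horizon I \<and> a t}"

text \<open>A policy maps the current numbers of sales to the product offered to an arriving customer;
  \<^const>\<open>None\<close> means rejection.\<close>

type_synonym policy = "(nat \<Rightarrow> nat) \<Rightarrow> nat option"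

fun sales :: "policy \<Rightarrow> (nat \<Rightarrow> bool) \<Rightarrow> nat \<Rightarrow> nat \<Rightarrow> nat" where
  "sales \<pi> a 0 = (\<lambda>_. 0)"
| "sales \<pi> a (Suc t) =
     (let x = sales \<pi> a t in
      if a t then (case \<pi> x of None \<Rightarrow> x | Some i \<Rightarrow> x(i := Suc (x i))) else x)"

definition period_reward :: "alloc \<Rightarrow> policy \<Rightarrow> (nat \<Rightarrow> bool) \<Rightarrow> nat \<Rightarrow> real" where
  "period_reward I \<pi> a t =
     (let x = sales \<pi> a t in
      if a t then (case \<pi> x of None \<Rightarrow> 0 | Some i \<Rightarrow> base_reward I i + bonus I i (Suc (x i)))
      else 0)"

definition revenue :: "alloc \<Rightarrow> policy \<Rightarrow> (nat \<Rightarrow> bool) \<Rightarrow> real" where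
  "revenue I \<pi> a = (\<Sum>t<horizon I. period_reward I \<pi> a t)"

definition expected_revenue :: "alloc \<Rightarrow> policy \<Rightarrow> real" where
  "expected_revenue I \<pi> = measure_pmf.expectation (arrivals I) (revenue I \<pi>)"

definition expected_offline :: "alloc \<Rightarrow> real" where
  "expected_offline I =
     measure_pmf.expectation (arrivals I) (\<lambda>a. offline I (num_arrivals I a))"

definition fill :: "alloc \<Rightarrow> nat list \<Rightarrow> policy" where
  "fill I \<sigma> x = find (\<lambda>i. x i < capacity I i) \<sigma>"

definition ordering :: "alloc \<Rightarrow> nat list \<Rightarrow> bool" where
  "ordering I \<sigma> \<longleftrightarrow> distinct \<sigma> \<and> set \<sigma> = {..<products I}"

definition base_ordering :: "alloc \<Rightarrow> nat list \<Rightarrow> bool" where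
  "base_ordering I \<sigma> \<longleftrightarrow>
     ordering I \<sigma> \<and> sorted_wrt (\<lambda>i j. base_reward I i \<ge> base_reward I j) \<sigma>"

definition cap_ordering :: "alloc \<Rightarrow> nat list \<Rightarrow> bool" where
  "cap_ordering I \<sigma> \<longleftrightarrow>
     ordering I \<sigma> \<and> sorted_wrt (\<lambda>i j. capacity I i \<ge> capacity I j) \<sigma>"


section \<open>A unit-cost real RAM\<close>

text \<open>The memory consists of named arrays of natural numbers and named arrays of reals; cell 0 of
  an array serves as a scalar variable. Reading a cell, evaluating a literal, and each arithmetic
  operation, comparison, connective and elementary command cost one unit. As usual for the real
  RAM, reals cannot be converted to natural numbers; natural numbers can only be added and
  subtracted, and programs contain no real literals other than 0 and 1.\<close>

type_synonym memory = "(string \<Rightarrow> nat \<Rightarrow> nat) \<times> (string \<Rightarrow> nat \<Rightarrow> real)"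

datatype nexp =
    NLit nat
  | NGet string nexp
  | NAdd nexp nexp
  | NSub nexp nexp

datatype rexp =
    RZero
  | ROne
  | RGet string nexp
  | RAdd rexp rexp
  | RSub rexp rexp
  | RMul rexp rexp

datatype bexp =
    NLess nexp nexp
  | RLess rexp rexp
  | Neg bexp
  | Conj bexp bexp

datatype com =
    Skip
  | NSet string nexp nexp
  | RSet string nexp rexp
  | Seq com com
  | Cond bexp com com
  | While bexp com

fun nval :: "nexp \<Rightarrow> memory \<Rightarrow> nat" where
  "nval (NLit n) s = n"
| "nval (NGet x e) s = fst s x (nval e s)"
| "nval (NAdd d e) s = nval d s + nval e s"
| "nval (NSub d e) s = nval d s - nval e s"

fun rval :: "rexp \<Rightarrow> memory \<Rightarrow> real" where
  "rval RZero s = 0"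
| "rval ROne s = 1"
| "rval (RGet x e) s = snd s x (nval e s)"
| "rval (RAdd d e) s = rval d s + rval e s"
| "rval (RSub d e) s = rval d s - rval e s"
| "rval (RMul d e) s = rval d s * rval e s"

fun bval :: "bexp \<Rightarrow> memory \<Rightarrow> bool" where
  "bval (NLess d e) s \<longleftrightarrow> nval d s < nval e s"
| "bval (RLess d e) s \<longleftrightarrow> rval d s < rval e s"
| "bval (Neg b) s \<longleftrightarrow> \<not> bval b s"
| "bval (Conj b c) s \<longleftrightarrow> bval b s \<and> bval c s"

fun ncost :: "nexp \<Rightarrow> nat" where
  "ncost (NLit n) = 1"
| "ncost (NGet x e) = 1 + ncost e"
| "ncost (NAdd d e) = 1 + ncost d + ncost e"
| "ncost (NSub d e) = 1 + ncost d + ncost e"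

fun rcost :: "rexp \<Rightarrow> nat" where
  "rcost RZero = 1"
| "rcost ROne = 1"
| "rcost (RGet x e) = 1 + ncost e"
| "rcost (RAdd d e) = 1 + rcost d + rcost e"
| "rcost (RSub d e) = 1 + rcost d + rcost e"
| "rcost (RMul d e) = 1 + rcost d + rcost e"

fun bcost :: "bexp \<Rightarrow> nat" where
  "bcost (NLess d e) = 1 + ncost d + ncost e"
| "bcost (RLess d e) = 1 + rcost d + rcost e"
| "bcost (Neg b) = 1 + bcost b"
| "bcost (Conj b c) = 1 + bcost b + bcost c"

definition nupd :: "string \<Rightarrow> nat \<Rightarrow> nat \<Rightarrow> memory \<Rightarrow> memory" where
  "nupd x i v s = ((fst s)(x := (fst s x)(i := v)), snd s)"

definition rupd :: "string \<Rightarrow> nat \<Rightarrow> real \<Rightarrow> memory \<Rightarrow> memory" where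
  "rupd x i v s = (fst s, (snd s)(x := (snd s x)(i := v)))"

text \<open>\<open>exec c s n s'\<close>: started in \<open>s\<close>, the command \<open>c\<close> terminates in \<open>s'\<close> at cost \<open>n\<close>.\<close>

inductive exec :: "com \<Rightarrow> memory \<Rightarrow> nat \<Rightarrow> memory \<Rightarrow> bool" where
  Skip: "exec Skip s 1 s"
| NSet: "exec (NSet x d e) s (1 + ncost d + ncost e) (nupd x (nval d s) (nval e s) s)"
| RSet: "exec (RSet x d e) s (1 + ncost d + rcost e) (rupd x (nval d s) (rval e s) s)"
| Seq: "exec c s n s' \<Longrightarrow> exec d s' n' s'' \<Longrightarrow> exec (Seq c d) s (n + n') s''"
| CondTrue: "bval b s \<Longrightarrow> exec c s n s' \<Longrightarrow> exec (Cond b c d) s (1 + bcost b + n) s'"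
| CondFalse: "\<not> bval b s \<Longrightarrow> exec d s n s' \<Longrightarrow> exec (Cond b c d) s (1 + bcost b + n) s'"
| WhileFalse: "\<not> bval b s \<Longrightarrow> exec (While b c) s (1 + bcost b) s"
| WhileTrue: "bval b s \<Longrightarrow> exec c s n s' \<Longrightarrow> exec (While b c) s' n' s'' \<Longrightarrow>
    exec (While b c) s (1 + bcost b + n + n') s''"

inductive_cases exec_SkipE: "exec Skip s n s'"
  and exec_NSetE: "exec (NSet x d e) s n s'"
  and exec_RSetE: "exec (RSet x d e) s n s'"
  and exec_SeqE: "exec (Seq c d) s n s'"
  and exec_CondE: "exec (Cond b c d) s n s'"
  and exec_WhileE: "exec (While b c) s n s'"

lemma exec_deterministic: "exec c s n s' \<Longrightarrow> exec c s k t \<Longrightarrow> k = n \<and> t = s'"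
proof (induction arbitrary: k t rule: exec.induct)
  case (Seq c s n s' d n' s'')
  from Seq.prems obtain n1 s1 n2 where "k = n1 + n2" "exec c s n1 s1" "exec d s1 n2 t"
    by (rule exec_SeqE)
  with Seq.IH(1)[of n1 s1] Seq.IH(2)[of n2 t] show ?case by simp
next
  case (CondTrue b s c n s' d)
  from CondTrue.prems CondTrue.hyps obtain n1 where "k = 1 + bcost b + n1" "exec c s n1 t"
    by (elim exec_CondE) simp_all
  with CondTrue.IH[of n1 t] show ?case by simp
next
  case (CondFalse b s d n s' c)
  from CondFalse.prems CondFalse.hyps obtain n1 where "k = 1 + bcost b + n1" "exec d s n1 t"
    by (elim exec_CondE) simp_all
  with CondFalse.IH[of n1 t] show ?case by simp
next
  case (WhileFalse b s c)
  from WhileFalse.prems show ?case by (rule exec_WhileE) (use WhileFalse.hyps in simp_all)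
next
  case (WhileTrue b s c n s' n' s'')
  from WhileTrue.prems obtain n1 s1 n2
    where "k = 1 + bcost b + n1 + n2" "exec c s n1 s1" "exec (While b c) s1 n2 t"
    by (rule exec_WhileE) (use WhileTrue.hyps(1) in simp_all)
  with WhileTrue.IH(1)[of n1 s1] WhileTrue.IH(2)[of n2 t] show ?case by simp
next
  case Skip then show ?case by (elim exec_SkipE) simp
next
  case NSet then show ?case by (elim exec_NSetE) simp
next
  case RSet then show ?case by (elim exec_RSetE) simp
qed


section \<open>Selecting between two fill algorithms on the real RAM\<close>

text \<open>The input consists of the instance data, with the common bonus function \<open>f\<close> as a table, and
  of the two orderings. All cells not mentioned here are 0.\<close>

definition encode :: "alloc \<Rightarrow> (nat \<Rightarrow> real) \<Rightarrow> nat list \<Rightarrow> nat list \<Rightarrow> memory" where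
  "encode I f \<sigma> \<tau> =
     ((\<lambda>_ _. 0)
        (''products'' := (\<lambda>k. if k = 0 then products I else 0),
         ''horizon'' := (\<lambda>k. if k = 0 then horizon I else 0),
         ''capacity'' := (\<lambda>i. if i < products I then capacity I i else 0),
         ''order1'' := (\<lambda>k. if k < length \<sigma> then \<sigma> ! k else 0),
         ''order2'' := (\<lambda>k. if k < length \<tau> then \<tau> ! k else 0)),
      (\<lambda>_ _. 0)
        (''base'' := (\<lambda>i. if i < products I then base_reward I i else 0),
         ''bonus'' := f,
         ''prob'' := (\<lambda>t. if t < horizon I then arrival_prob I t else 0)))"

text \<open>The program announces its choice in cell 0 of \<open>out\<close>: 0 for the first ordering, any other
  value for the second.\<close>

definition selected :: "memory \<Rightarrow> nat list \<Rightarrow> nat list \<Rightarrow> nat list" where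
  "selected s \<sigma> \<tau> = (if fst s ''out'' 0 = 0 then \<sigma> else \<tau>)"

text \<open>The time bound \<open>O(T C)\<close>. Products without capacity contribute nothing to \<open>C\<close>, but they occur
  in the orderings and may have to be skipped there, hence the middle summand; the last one pays
  for the bounded work when \<open>T C = 0\<close>. If all capacities are positive and \<open>T C > 0\<close>, the bound is
  at most \<open>2 T C\<close>.\<close>

definition time_bound :: "alloc \<Rightarrow> nat" where
  "time_bound I =
     horizon I * total_capacity I + card {i. i < products I \<and> capacity I i = 0} + 1"

end

theory Submission
  imports Defs
begin

text \<open>Writing \<open>R\<^sub>i n = n r\<^sub>i + F n\<close> with \<open>F n = f 1 + \<dots> + f n\<close>, the offline optimum is at most the
  maximum of \<open>\<Sum>n\<^sub>i r\<^sub>i\<close> plus the maximum of \<open>\<Sum>F n\<^sub>i\<close>. Filling by base reward attains the first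
  maximum and, \<open>F\<close> being convex, filling by capacity attains the second. Hence
  \<open>U l \<le> Rev\<^sup>b\<^sup>a\<^sup>s\<^sup>e + Rev\<^sup>c\<^sup>a\<^sup>p\<close> on every path with \<open>l\<close> arrivals, and the better of the two fills earns at
  least half of the optimum in expectation.

  The revenue of a fill depends only on the number of arrivals. Its expectation is therefore found
  by tabulating it over \<open>0, ..., C\<close> and averaging the table over one period at a time, which takes
  \<open>T (C + 1)\<close> updates.\<close>

section \<open>Greedy filling\<close>

text \<open>Closed form of the state a fill reaches after \<open>l\<close> units; the truncated
  difference \<open>l - b i\<close> is the overflow passed on to the later products.\<close>

fun fill_state :: "('a \<Rightarrow> nat) \<Rightarrow> 'a list \<Rightarrow> nat \<Rightarrow> 'a \<Rightarrow> nat" where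
  "fill_state b [] l = (\<lambda>_. 0)"
| "fill_state b (i # is) l = (fill_state b is (l - b i))(i := min (b i) l)"

fun fill_value :: "('a \<Rightarrow> nat) \<Rightarrow> ('a \<Rightarrow> nat \<Rightarrow> real) \<Rightarrow> 'a list \<Rightarrow> nat \<Rightarrow> real" where
  "fill_value b G [] l = 0"
| "fill_value b G (i # is) l = G i (min (b i) l) + fill_value b G is (l - b i)"

lemma fill_value_eq_sum_list:
  "distinct is \<Longrightarrow> fill_value b G is l = (\<Sum>i\<leftarrow>is. G i (fill_state b is l i))"
proof (induction "is" arbitrary: l)
  case (Cons i "is")
  have "(\<Sum>j\<leftarrow>is. G j (fill_state b (i # is) l j)) = (\<Sum>j\<leftarrow>is. G j (fill_state b is (l - b i) j))"
    using Cons.prems by (intro arg_cong[where f = sum_list] map_cong) auto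
  then show ?case using Cons by simp
qed simp

lemma fill_value_add:
  "fill_value b (\<lambda>i n. G i n + H i n) is l = fill_value b G is l + fill_value b H is l"
  by (induction "is" arbitrary: l) simp_all

lemma fill_value_nonneg:
  "(\<And>i n. i \<in> set is \<Longrightarrow> 0 \<le> G i n) \<Longrightarrow> 0 \<le> fill_value b G is l"
  by (induction "is" arbitrary: l) simp_all

lemma fill_value_cong:
  "(\<And>i n. i \<in> set is \<Longrightarrow> G i n = H i n) \<Longrightarrow> fill_value b G is l = fill_value b H is l"
  by (induction "is" arbitrary: l) simp_all

text \<open>The \<open>n\<close> extra units reach \<open>js\<close> exactly when all of
  \<open>is\<close> is full. This yields both saturation and the unit-by-unit recurrence behind the
  table.\<close>

lemma fill_value_append:
  "fill_value b G (is @ js) ((\<Sum>i\<leftarrow>is. b i) + n) = (\<Sum>i\<leftarrow>is. G i (b i)) + fill_value b G js n"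
  by (induction "is") (simp_all add: add.assoc min_def)

lemma fill_value_0: "(\<And>i. i \<in> set is \<Longrightarrow> G i 0 = 0) \<Longrightarrow> fill_value b G is 0 = 0"
  by (induction "is") simp_all

lemma fill_value_saturated:
  "(\<Sum>i\<leftarrow>is. b i) \<le> l \<Longrightarrow> fill_value b G is l = (\<Sum>i\<leftarrow>is. G i (b i))"
  using fill_value_append[of b G "is" "[]" "l - (\<Sum>i\<leftarrow>is. b i)"] by simp

text \<open>Units are moved to the first product from one of the others at a time, until it is full or
  the others are empty; the hypothesis says that no single such move decreases the value.\<close>

lemma pour_into_first:
  fixes b x :: "'a \<Rightarrow> nat" and G :: "'a \<Rightarrow> nat \<Rightarrow> real"
  assumes "\<And>j a c. j \<in> set is \<Longrightarrow> a \<le> b i \<Longrightarrow> c \<le> b j \<Longrightarrow>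
      G i a + G j c \<le> G i (min (b i) (a + c)) + G j (a + c - min (b i) (a + c))"
    and "distinct is" and "a \<le> b i" and "\<And>j. j \<in> set is \<Longrightarrow> x j \<le> b j"
  obtains y where "\<And>j. j \<in> set is \<Longrightarrow> y j \<le> b j"
    and "(\<Sum>j\<leftarrow>is. y j) = a + (\<Sum>j\<leftarrow>is. x j) - b i"
    and "G i a + (\<Sum>j\<leftarrow>is. G j (x j)) \<le>
      G i (min (b i) (a + (\<Sum>j\<leftarrow>is. x j))) + (\<Sum>j\<leftarrow>is. G j (y j))"
  using assms
proof (induction "is" arbitrary: a thesis)
  case Nil
  then show ?case by (simp add: min_absorb2)
next
  case (Cons j "is")
  \<comment> \<open>Pour product \<open>j\<close> into the first one: \<open>?c\<close> is what does
    not fit, hence 0 unless the first becomes full.\<close>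
  let ?a = "min (b i) (a + x j)" and ?c = "a + x j - b i"
  have le: "x j \<le> b j" "a \<le> b i" using Cons.prems by auto
  have pair: "G i a + G j (x j) \<le> G i ?a + G j ?c"
    using Cons.prems(2)[of j a "x j"] le by (simp add: min_def split: if_splits)
  obtain y where y: "\<And>j. j \<in> set is \<Longrightarrow> y j \<le> b j"
    "(\<Sum>j\<leftarrow>is. y j) = ?a + (\<Sum>j\<leftarrow>is. x j) - b i"
    "G i ?a + (\<Sum>j\<leftarrow>is. G j (x j)) \<le>
      G i (min (b i) (?a + (\<Sum>j\<leftarrow>is. x j))) + (\<Sum>j\<leftarrow>is. G j (y j))"
    using Cons.IH[of ?a] Cons.prems(2,3,5) by force
  \<comment> \<open>The induction hypothesis leaves \<open>y j\<close> arbitrary, and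
    \<open>j\<close> does not occur in \<open>is\<close>, so this value can be overwritten.\<close>
  let ?y = "y(j := ?c)"
  have upd: "(\<Sum>k\<leftarrow>is. H k (?y k)) = (\<Sum>k\<leftarrow>is. H k (y k))"
    for H :: "'a \<Rightarrow> nat \<Rightarrow> 'c :: monoid_add"
    using Cons.prems(3) by (intro arg_cong[where f = sum_list] map_cong) auto
  have "min (b i) (?a + (\<Sum>j\<leftarrow>is. x j)) = min (b i) (a + (\<Sum>j\<leftarrow>j # is. x j))"
    by auto
  then have gain: "G i a + (\<Sum>j\<leftarrow>j # is. G j (x j)) \<le>
      G i (min (b i) (a + (\<Sum>j\<leftarrow>j # is. x j))) + (\<Sum>k\<leftarrow>j # is. G k (?y k))"
    using pair y(3) by (simp add: upd fun_upd_same del: fun_upd_apply)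
  have total: "(\<Sum>k\<leftarrow>j # is. ?y k) = a + (\<Sum>j\<leftarrow>j # is. x j) - b i"
    using y(2) upd[of "\<lambda>_ n. n"] by (simp add: fun_upd_same min_def del: fun_upd_apply)
  have bounded: "?y k \<le> b k" if "k \<in> set (j # is)" for k
    using that y(1) le by auto
  show ?case by (rule Cons.prems(1)[OF bounded total gain])
qed

text \<open>Pouring fills the first product as far as the total \<open>?S\<close> allows and leaves
  \<open>?S - b i \<le> l - b i\<close> units, a feasible allocation of the tail. Monotonicity then
  replaces \<open>?S\<close> by \<open>l\<close>. Exchanges go only from a later product to an
  earlier one, which is what sorting supplies.\<close>

lemma fill_value_optimal:
  assumes "sorted_wrt (\<lambda>i j. \<forall>a\<le>b i. \<forall>c\<le>b j.
      G i a + G j c \<le> G i (min (b i) (a + c)) + G j (a + c - min (b i) (a + c))) is"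
    and "distinct is" and "\<And>i. i \<in> set is \<Longrightarrow> mono (G i)"
    and "\<And>i. i \<in> set is \<Longrightarrow> x i \<le> b i" and "(\<Sum>i\<leftarrow>is. x i) \<le> l"
  shows "(\<Sum>i\<leftarrow>is. G i (x i)) \<le> fill_value b G is l"
  using assms
proof (induction "is" arbitrary: x l)
  case (Cons i "is")
  let ?S = "x i + (\<Sum>j\<leftarrow>is. x j)"
  obtain y where y: "\<And>j. j \<in> set is \<Longrightarrow> y j \<le> b j" "(\<Sum>j\<leftarrow>is. y j) = ?S - b i"
    "G i (x i) + (\<Sum>j\<leftarrow>is. G j (x j)) \<le> G i (min (b i) ?S) + (\<Sum>j\<leftarrow>is. G j (y j))"
    by (rule pour_into_first[of "is" b i G "x i" x]) (use Cons.prems in auto)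
  have "(\<Sum>j\<leftarrow>is. G j (y j)) \<le> fill_value b G is (l - b i)"
    using Cons.prems y(1,2) by (intro Cons.IH) auto
  moreover have "G i (min (b i) ?S) \<le> G i (min (b i) l)"
    using Cons.prems by (intro monoD[of "G i"]) auto
  ultimately show ?case using y(3) by simp
qed simp

text \<open>Convexity of partial sums of a nondecreasing \<open>f\<close>: with
  \<open>e = a - d = a' - c\<close>, both sides share the first \<open>d\<close> and the first
  \<open>c\<close> terms and differ in \<open>e\<close> terms starting after \<open>d\<close> on the
  left and after \<open>c \<ge> d\<close> on the right.\<close>

lemma sum_mono_shift_le:
  fixes f :: "nat \<Rightarrow> real"
  assumes "mono f" and "a \<le> a'" and "c \<le> a'" and "a + c = a' + d"
  shows "(\<Sum>k=1..a. f k) + (\<Sum>k=1..c. f k) \<le> (\<Sum>k=1..a'. f k) + (\<Sum>k=1..d. f k)"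
proof -
  have split: "(\<Sum>k=1..n + e. f k) = (\<Sum>k=1..n. f k) + (\<Sum>k=1..e. f (n + k))" for n e
    by (induction e) simp_all
  define e where "e = a - d"
  have a: "a = d + e" and a': "a' = c + e" and "d \<le> c" using assms e_def by auto
  then have "(\<Sum>k=1..e. f (d + k)) \<le> (\<Sum>k=1..e. f (c + k))"
    by (intro sum_mono monoD[OF assms(1)]) simp
  then show ?thesis unfolding a a' split by simp
qed


section \<open>Revenue of a fill algorithm\<close>

lemma reward_0: "reward I i 0 = 0"
  by (simp add: reward_def)

lemma reward_Suc: "reward I i (Suc n) = reward I i n + base_reward I i + bonus I i (Suc n)"
  by (simp add: reward_def algebra_simps)

lemma sum_list_ordering:
  assumes "ordering I \<sigma>"
  shows "(\<Sum>i\<leftarrow>\<sigma>. g i) = (\<Sum>i<products I. g i)"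
  using assms by (simp add: ordering_def sum_list_distinct_conv_sum_set)

text \<open>The period rewards telescope: each sale adds the increment of \<open>reward\<close> for
  the product sold, whose index lies in the summation range.\<close>

lemma sum_period_reward:
  assumes "\<And>x i. \<pi> x = Some i \<Longrightarrow> i < products I"
  shows "(\<Sum>t<n. period_reward I \<pi> a t) = (\<Sum>i<products I. reward I i (sales \<pi> a n i))"
proof (induction n)
  case 0
  then show ?case by (simp add: reward_0)
next
  case (Suc n)
  let ?x = "sales \<pi> a n"
  have "(\<Sum>i<products I. reward I i ((?x(j := Suc (?x j))) i)) =
      (\<Sum>i<products I. reward I i (?x i)) + (base_reward I j + bonus I j (Suc (?x j)))"
    if "j < products I" for j
  proof -
    have "(\<Sum>i<products I. reward I i ((?x(j := Suc (?x j))) i)) =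
        (\<Sum>i<products I. reward I i (?x i) +
          (if i = j then base_reward I j + bonus I j (Suc (?x j)) else 0))"
      by (intro sum.cong) (auto simp: reward_Suc)
    then show ?thesis using that by (simp add: sum.distrib)
  qed
  then show ?case
    using Suc assms[of ?x] by (auto simp: Let_def period_reward_def split: option.split)
qed

text \<open>Search and recursion branch alike: for \<open>n < b i\<close> the first product is
  chosen; afterwards it is full and both continue in the tail with \<open>n - b i\<close>
  units.\<close>

lemma fill_fill_state:
  assumes "distinct \<sigma>"
  shows "(case find (\<lambda>i. fill_state b \<sigma> n i < b i) \<sigma> of None \<Rightarrow> fill_state b \<sigma> n
      | Some i \<Rightarrow> (fill_state b \<sigma> n)(i := Suc (fill_state b \<sigma> n i))) = fill_state b \<sigma> (Suc n)"
  using assms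
proof (induction \<sigma> arbitrary: n)
  case (Cons i "is")
  let ?x = "fill_state b is (n - b i)"
  show ?case
  proof (cases "n < b i")
    case True
    then show ?thesis by simp
  next
    case False
    \<comment> \<open>Since \<open>i\<close> is absent from the tail, its entry neither affects the
      search nor collides with the update of the product found.\<close>
    have "find (\<lambda>j. (?x(i := min (b i) n)) j < b j) is = find (\<lambda>j. ?x j < b j) is"
      using Cons.prems by (intro find_cong) auto
    moreover have "find (\<lambda>j. ?x j < b j) is \<noteq> Some i"
      using Cons.prems by (auto simp: find_Some_iff)
    moreover have "(?x(i := b i))(j := c) = (?x(j := c))(i := b i)" if "j \<noteq> i" for j c
      using that by (simp add: fun_upd_twist)
    ultimately show ?thesis
      using False Cons.IH[of "n - b i"] Cons.prems
      by (cases "find (\<lambda>j. ?x j < b j) is") 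
        (auto simp: Suc_diff_le fun_upd_same fun_upd_other simp del: fun_upd_apply)
  qed
qed simp

lemma Collect_less_Suc_conj:
  "{s. s < Suc t \<and> a s} = (if a t then insert t {s. s < t \<and> a s} else {s. s < t \<and> a s})"
  by (auto simp: less_Suc_eq)

lemma sales_fill:
  assumes "distinct \<sigma>"
  shows "sales (fill I \<sigma>) a t = fill_state (capacity I) \<sigma> (card {s. s < t \<and> a s})"
proof (induction t)
  case 0
  have "fill_state b \<sigma> 0 = (\<lambda>_. 0)" for b :: "nat \<Rightarrow> nat"
    by (induction \<sigma>) auto
  then show ?case by simp
next
  case (Suc t)
  then show ?case
    using fill_fill_state[OF assms, of "capacity I"]
    by (simp add: Let_def fill_def Collect_less_Suc_conj)
qed

lemma revenue_fill:
  assumes "ordering I \<sigma>"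
  shows "revenue I (fill I \<sigma>) a =
    fill_value (capacity I) (reward I) \<sigma> (num_arrivals I a)"
proof -
  have "fill I \<sigma> x = Some i \<Longrightarrow> i < products I" for x i
    using assms by (auto simp: fill_def ordering_def find_Some_iff)
  then have "revenue I (fill I \<sigma>) a =
      (\<Sum>i<products I. reward I i (sales (fill I \<sigma>) a (horizon I) i))"
    unfolding revenue_def by (intro sum_period_reward) auto
  also have "\<dots> = (\<Sum>i\<leftarrow>\<sigma>. reward I i (fill_state (capacity I) \<sigma> (num_arrivals I a) i))"
    using assms by (subst sum_list_ordering[OF assms])
      (simp add: sales_fill ordering_def num_arrivals_def)
  finally show ?thesis
    using assms by (simp add: fill_value_eq_sum_list ordering_def)
qed

text \<open>The mean of \<open>h\<close> over the number of arrivals in the first \<open>t\<close> periods, where averaging over the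
  last period is absorbed into \<open>h\<close>. This is the form in which the program computes it.\<close>

fun arrival_mean :: "(nat \<Rightarrow> real) \<Rightarrow> nat \<Rightarrow> (nat \<Rightarrow> real) \<Rightarrow> real" where
  "arrival_mean p 0 h = h 0"
| "arrival_mean p (Suc t) h = arrival_mean p t (\<lambda>n. h n + p t * (h (Suc n) - h n))"

section \<open>Expectations of functions of the number of arrivals\<close>

lemma finite_set_Pi_bernoulli:
  "finite (set_pmf (Pi_pmf {..<t::nat} False (\<lambda>t. bernoulli_pmf (p t))))"
  by (subst set_Pi_pmf) (auto intro!: finite_PiE_dflt)

text \<open>Condition on the last period, which is independent of the earlier ones: given
  \<open>?N a\<close> earlier arrivals, the mean over it is the function that
  \<open>arrival_mean\<close> passes down. Hence the induction varies \<open>h\<close>.\<close>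

lemma expectation_Pi_bernoulli:
  assumes "\<And>s. s < t \<Longrightarrow> 0 \<le> p s \<and> p s \<le> 1"
  shows "measure_pmf.expectation (Pi_pmf {..<t} False (\<lambda>t. bernoulli_pmf (p t)))
      (\<lambda>a. h (card {s. s < t \<and> a s})) = arrival_mean p t h"
  using assms
proof (induction t arbitrary: h)
  case 0
  then show ?case by simp
next
  case (Suc t)
  let ?M = "\<lambda>t. Pi_pmf {..<t} False (\<lambda>t. bernoulli_pmf (p t))"
  let ?N = "\<lambda>a. card {s. s < t \<and> a s}"
  have int: "integrable (?M t) g" for g :: "_ \<Rightarrow> real"
    by (intro integrable_measure_pmf_finite finite_set_Pi_bernoulli)
  have card: "card {s. s < Suc t \<and> (a(t := y)) s} = (if y then Suc (?N a) else ?N a)" for a y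
  proof -
    have "{s. s < t \<and> (a(t := y)) s} = {s. s < t \<and> a s}" by auto
    then show ?thesis by (simp add: Collect_less_Suc_conj)
  qed
  have "?M (Suc t) = bernoulli_pmf (p t) \<bind> (\<lambda>y. map_pmf (\<lambda>a. a(t := y)) (?M t))"
    by (simp add: lessThan_Suc Pi_pmf_insert' map_pmf_def)
  then have "measure_pmf.expectation (?M (Suc t)) (\<lambda>a. h (card {s. s < Suc t \<and> a s})) =
      measure_pmf.expectation (bernoulli_pmf (p t)) (\<lambda>y.
        measure_pmf.expectation (?M t) (\<lambda>a. h (if y then Suc (?N a) else ?N a)))"
    by (simp add: pmf_expectation_bind[of UNIV] finite_set_Pi_bernoulli card
        integral_measure_pmf_real[of UNIV] mult.commute del: fun_upd_apply)
  also have "\<dots> = p t * measure_pmf.expectation (?M t) (\<lambda>a. h (Suc (?N a))) +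
      (1 - p t) * measure_pmf.expectation (?M t) (\<lambda>a. h (?N a))"
    using Suc.prems[of t] by simp
  also have "\<dots> = measure_pmf.expectation (?M t)
      (\<lambda>a. h (?N a) + p t * (h (Suc (?N a)) - h (?N a)))"
    by (simp add: int algebra_simps)
  also have "\<dots> = arrival_mean p (Suc t) h"
    using Suc.IH[of "\<lambda>n. h n + p t * (h (Suc n) - h n)"] Suc.prems by simp
  finally show ?case .
qed

lemma expected_revenue_fill:
  assumes "valid_alloc I" and "ordering I \<sigma>"
  shows "expected_revenue I (fill I \<sigma>) =
    arrival_mean (arrival_prob I) (horizon I) (fill_value (capacity I) (reward I) \<sigma>)"
  using assms unfolding expected_revenue_def revenue_fill[OF assms(2)] num_arrivals_def arrivals_def
  by (subst expectation_Pi_bernoulli) (auto simp: valid_alloc_def)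


section \<open>The approximation guarantee\<close>

lemma offline_le_base_plus_cap:
  assumes valid: "valid_alloc I" and hom: "homogeneous I f"
    and base: "base_ordering I \<sigma>" and cap: "cap_ordering I \<tau>"
  shows "offline I l \<le>
    fill_value (capacity I) (reward I) \<sigma> l + fill_value (capacity I) (reward I) \<tau> l"
proof -
  define B F where "B = (\<lambda>i n. real n * base_reward I i)" and "F = (\<lambda>n. \<Sum>k=1..n. f k)"
  let ?fill = "fill_value (capacity I)"
  have ord: "ordering I \<sigma>" "ordering I \<tau>"
    using base cap by (auto simp: base_ordering_def cap_ordering_def)
  have r: "0 \<le> base_reward I i" if "i < products I" for i
    using valid that by (auto simp: valid_alloc_def)
  \<comment> \<open>Homogeneity constrains \<open>f\<close> only through an existing product, so the
    facts about \<open>f\<close> and \<open>F\<close> are conditioned on some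
    \<open>i < products I\<close>.\<close>
  have f: "0 \<le> f k" "mono f" if "i < products I" for i k
    using valid hom that by (auto simp: valid_alloc_def homogeneous_def)
  have reward: "reward I i n = B i n + F n" if "i < products I" for i n
    using hom that by (simp add: reward_def homogeneous_def B_def F_def)
  have B0: "0 \<le> B i n" and F0: "0 \<le> F n" if "i < products I" for i n
    using r f that by (auto simp: B_def F_def intro!: sum_nonneg)
  have mono_B: "mono (B i)" and mono_F: "mono F" if "i < products I" for i
    using r f that by (auto simp: B_def F_def intro!: monoI mult_right_mono sum_mono2)
  have fill_reward: "?fill (reward I) \<rho> l = ?fill B \<rho> l + ?fill (\<lambda>_. F) \<rho> l"
    if "ordering I \<rho>" for \<rho>
    unfolding fill_value_add[symmetric]
    by (intro fill_value_cong) (use that reward in \<open>auto simp: ordering_def\<close>)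
  have opt: "(\<Sum>i<products I. reward I i (x i)) \<le> ?fill (reward I) \<sigma> l + ?fill (reward I) \<tau> l"
    if x: "\<And>i. i < products I \<Longrightarrow> x i \<le> capacity I i" "(\<Sum>i<products I. x i) \<le> l" for x
  proof -
    have "(\<Sum>i\<leftarrow>\<sigma>. B i (x i)) \<le> ?fill B \<sigma> l"
    proof (rule fill_value_optimal)
      have "B i a + B j c \<le> B i (min b (a + c)) + B j (a + c - min b (a + c))"
        if "base_reward I j \<le> base_reward I i" "a \<le> b" for i j a b c
      proof -
        \<comment> \<open>\<open>d\<close> units move from \<open>j\<close> to \<open>i\<close>,
          each gaining the nonnegative difference of the base rewards.\<close>
        define d where "d = min b (a + c) - a"
        have "min b (a + c) = a + d" "d \<le> c" using that by (auto simp: d_def)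
        moreover have "real d * base_reward I j \<le> real d * base_reward I i"
          using that by (intro mult_left_mono) auto
        ultimately show ?thesis by (simp add: B_def algebra_simps of_nat_diff)
      qed
      then show "sorted_wrt (\<lambda>i j. \<forall>a\<le>capacity I i. \<forall>c\<le>capacity I j.
          B i a + B j c \<le> B i (min (capacity I i) (a + c)) +
            B j (a + c - min (capacity I i) (a + c))) \<sigma>"
        using base unfolding base_ordering_def by (auto intro: sorted_wrt_mono_rel[rotated])
    qed (use ord x mono_B sum_list_ordering[OF ord(1), of x] in \<open>auto simp: ordering_def\<close>)
    moreover have "(\<Sum>i\<leftarrow>\<tau>. F (x i)) \<le> ?fill (\<lambda>_. F) \<tau> l"
    proof (rule fill_value_optimal)
      \<comment> \<open>The bound \<open>c \<le> b\<close> comes from the capacity order. Then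
        \<open>min b (a + c)\<close> dominates both \<open>a\<close> and \<open>c\<close>, so
        convexity applies.\<close>
      have "F a + F c \<le> F (min b (a + c)) + F (a + c - min b (a + c))"
        if "i < products I" "a \<le> b" "c \<le> b" for i a b c
        unfolding F_def using that f by (intro sum_mono_shift_le) auto
      then have pour: "F a + F c \<le> F (min (capacity I i) (a + c)) + F (a + c - min (capacity I i) (a + c))"
        if "i \<in> set \<tau>" "capacity I j \<le> capacity I i" "a \<le> capacity I i" "c \<le> capacity I j" for i j a c
        using that ord(2) by (force simp: ordering_def)
      have "sorted_wrt (\<lambda>i j. capacity I j \<le> capacity I i) \<tau>"
        using cap by (simp add: cap_ordering_def)
      then show "sorted_wrt (\<lambda>i j. \<forall>a\<le>capacity I i. \<forall>c\<le>capacity I j.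
          F a + F c \<le> F (min (capacity I i) (a + c)) + F (a + c - min (capacity I i) (a + c))) \<tau>"
        by (rule sorted_wrt_mono_rel[rotated]) (auto intro: pour)
    qed (use ord x mono_F sum_list_ordering[OF ord(2), of x] in \<open>auto simp: ordering_def\<close>)
    \<comment> \<open>The bonus part of the base fill and the base part of the capacity fill are
      dropped.\<close>
    moreover have "0 \<le> ?fill (\<lambda>_. F) \<sigma> l" "0 \<le> ?fill B \<tau> l"
      using ord by (auto intro!: fill_value_nonneg B0 F0 simp: ordering_def)
    moreover have "(\<Sum>i<products I. reward I i (x i)) =
        (\<Sum>i\<leftarrow>\<sigma>. B i (x i)) + (\<Sum>i\<leftarrow>\<tau>. F (x i))"
      by (simp add: sum_list_ordering[OF ord(1)] sum_list_ordering[OF ord(2)] reward sum.distrib)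
    ultimately show ?thesis by (simp add: fill_reward ord)
  qed
  let ?X = "{x \<in> (\<Pi>\<^sub>E i\<in>{..<products I}. {..capacity I i}). (\<Sum>i<products I. x i) \<le> l}"
  have "finite ?X"
    by (rule finite_subset[of _ "\<Pi>\<^sub>E i\<in>{..<products I}. {..capacity I i}"])
      (auto intro: finite_PiE)
  moreover have "(\<lambda>i\<in>{..<products I}. 0) \<in> ?X" by auto
  ultimately show ?thesis
    unfolding offline_def by (intro Max.boundedI) (blast, blast, auto intro!: opt simp: PiE_iff)
qed

lemma expected_offline_le:
  assumes "valid_alloc I" and "homogeneous I f" and "base_ordering I \<sigma>" and "cap_ordering I \<tau>"
  shows "expected_offline I \<le> expected_revenue I (fill I \<sigma>) + expected_revenue I (fill I \<tau>)"
proof -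
  have ord: "ordering I \<sigma>" "ordering I \<tau>"
    using assms by (auto simp: base_ordering_def cap_ordering_def)
  have int: "integrable (arrivals I) g" for g :: "_ \<Rightarrow> real"
    unfolding arrivals_def by (intro integrable_measure_pmf_finite finite_set_Pi_bernoulli)
  have "expected_offline I \<le> measure_pmf.expectation (arrivals I)
      (\<lambda>a. revenue I (fill I \<sigma>) a + revenue I (fill I \<tau>) a)"
    unfolding expected_offline_def
    by (intro integral_mono int) (simp add: revenue_fill ord offline_le_base_plus_cap[OF assms])
  then show ?thesis by (simp add: int expected_revenue_def)
qed


section \<open>Loop-free commands and bounded loops\<close>

fun loop_free :: "com \<Rightarrow> bool" where
  "loop_free (Seq c d) \<longleftrightarrow> loop_free c \<and> loop_free d"
| "loop_free (Cond b c d) \<longleftrightarrow> loop_free c \<and> loop_free d"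
| "loop_free (While b c) \<longleftrightarrow> False"
| "loop_free c \<longleftrightarrow> True"

text \<open>The last equation also covers \<open>While\<close>, where its value is a dummy excluded
  by \<open>loop_free\<close>.\<close>

fun run :: "com \<Rightarrow> memory \<Rightarrow> memory" where
  "run (NSet x d e) s = nupd x (nval d s) (nval e s) s"
| "run (RSet x d e) s = rupd x (nval d s) (rval e s) s"
| "run (Seq c d) s = run d (run c s)"
| "run (Cond b c d) s = (if bval b s then run c s else run d s)"
| "run c s = s"

text \<open>A conditional is charged for both branches, a crude bound that avoids a maximum.\<close>

fun max_cost :: "com \<Rightarrow> nat" where
  "max_cost (NSet x d e) = 1 + ncost d + ncost e"
| "max_cost (RSet x d e) = 1 + ncost d + rcost e"
| "max_cost (Seq c d) = max_cost c + max_cost d"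
| "max_cost (Cond b c d) = 1 + bcost b + max_cost c + max_cost d"
| "max_cost c = 1"

lemma exec_loop_free:
  assumes "loop_free c"
  shows "\<exists>n. exec c s n (run c s) \<and> n \<le> max_cost c"
  using assms
proof (induction c arbitrary: s)
  case (Seq c d)
  from Seq.prems Seq.IH(1)[of s] Seq.IH(2)[of "run c s"]
  obtain n n' where n: "exec c s n (run c s)" "n \<le> max_cost c"
    "exec d (run c s) n' (run d (run c s))" "n' \<le> max_cost d"
    by auto
  from n(2,4) exec.Seq[OF n(1,3)] show ?case by (intro exI[of _ "n + n'"]) simp
next
  case (Cond b c d)
  from Cond.prems Cond.IH(1)[of s] Cond.IH(2)[of s]
  obtain n n' where n: "exec c s n (run c s)" "n \<le> max_cost c"
    "exec d s n' (run d s)" "n' \<le> max_cost d"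
    by auto
  show ?case
  proof (cases "bval b s")
    case True
    from True n(2) exec.CondTrue[OF True n(1), of d] show ?thesis
      by (intro exI[of _ "1 + bcost b + n"]) simp
  next
    case False
    from False n(4) exec.CondFalse[OF False n(3), of c] show ?thesis
      by (intro exI[of _ "1 + bcost b + n'"]) simp
  qed
qed (auto intro: exec.intros)

text \<open>The measure bounds the number of iterations; the extra 1 pays for the final failing
  test.\<close>

lemma exec_while:
  assumes "loop_free c"
    and "\<And>s. Inv s \<Longrightarrow> bval b s \<Longrightarrow> Inv (run c s) \<and> \<mu> (run c s) < \<mu> s"
    and "Inv s"
  shows "\<exists>n s'. exec (While b c) s n s' \<and> n \<le> (\<mu> s + 1) * (1 + bcost b + max_cost c) \<and>
    Inv s' \<and> \<not> bval b s'"
  using assms(3)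
proof (induction "\<mu> s" arbitrary: s rule: less_induct)
  case less
  let ?K = "1 + bcost b + max_cost c"
  show ?case
  proof (cases "bval b s")
    case False
    have "exec (While b c) s (1 + bcost b) s" by (rule exec.WhileFalse[OF False])
    with less.prems False show ?thesis
      by (intro exI[of _ "1 + bcost b"] exI[of _ s]) simp
  next
    case True
    have body: "Inv (run c s)" "\<mu> (run c s) < \<mu> s" using assms(2) less.prems True by auto
    obtain n where n: "exec c s n (run c s)" "n \<le> max_cost c"
      using exec_loop_free[OF assms(1)] by blast
    obtain n' s' where rest: "exec (While b c) (run c s) n' s'"
      "n' \<le> (\<mu> (run c s) + 1) * ?K" "Inv s'" "\<not> bval b s'"
      using less.hyps[OF body(2,1)] by blast
    have "n' \<le> \<mu> s * ?K"
      using body(2) by (intro order.trans[OF rest(2)] mult_le_mono1) simp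
    then have "1 + bcost b + n + n' \<le> (\<mu> s + 1) * ?K" using n(2) by simp
    with rest(3,4) exec.WhileTrue[OF True n(1) rest(1)] show ?thesis by blast
  qed
qed

section \<open>Frame property: arrays a command cannot change\<close>

fun nwrites :: "com \<Rightarrow> string set" where
  "nwrites (NSet x d e) = {x}"
| "nwrites (Seq c d) = nwrites c \<union> nwrites d"
| "nwrites (Cond b c d) = nwrites c \<union> nwrites d"
| "nwrites (While b c) = nwrites c"
| "nwrites c = {}"

fun rwrites :: "com \<Rightarrow> string set" where
  "rwrites (RSet x d e) = {x}"
| "rwrites (Seq c d) = rwrites c \<union> rwrites d"
| "rwrites (Cond b c d) = rwrites c \<union> rwrites d"
| "rwrites (While b c) = rwrites c"
| "rwrites c = {}"

lemma exec_frame: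
  assumes "exec c s n s'"
  shows "x \<notin> nwrites c \<Longrightarrow> fst s' x = fst s x" and "y \<notin> rwrites c \<Longrightarrow> snd s' y = snd s y"
  using assms by (induction rule: exec.induct) (auto simp: nupd_def rupd_def)


section \<open>Evaluating and comparing the two fill algorithms\<close>

text \<open>Variables: \<open>i\<close> is a position in the ordering, \<open>j\<close> the number of units already taken from
  the product there, \<open>k\<close> the total number of units taken, \<open>t\<close> the number of periods still to be
  averaged over, and \<open>n\<close> a position in the table.\<close>

abbreviation scalar :: "string \<Rightarrow> nexp" where
  "scalar x \<equiv> NGet x (NLit 0)"

abbreviation set_scalar :: "string \<Rightarrow> nexp \<Rightarrow> com" where
  "set_scalar x \<equiv> NSet x (NLit 0)"

text \<open>The nested loops over products and units are flattened: an iteration either takes one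
  unit or advances to the next product. The body is thus loop-free, as \<open>exec_while\<close>
  requires. \<open>average_body\<close> flattens periods and cells likewise.\<close>

definition tabulate_body :: "string \<Rightarrow> string \<Rightarrow> com" where
  "tabulate_body ord arr =
     Cond (NLess (scalar ''j'') (NGet ''capacity'' (NGet ord (scalar ''i''))))
       (Seq (set_scalar ''j'' (NAdd (scalar ''j'') (NLit 1)))
         (Seq (set_scalar ''k'' (NAdd (scalar ''k'') (NLit 1)))
           (RSet arr (scalar ''k'')
             (RAdd (RAdd (RGet arr (NSub (scalar ''k'') (NLit 1)))
                 (RGet ''base'' (NGet ord (scalar ''i''))))
               (RGet ''bonus'' (scalar ''j''))))))
       (Seq (set_scalar ''i'' (NAdd (scalar ''i'') (NLit 1))) (set_scalar ''j'' (NLit 0)))"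

text \<open>The table is overwritten in increasing order, so that cell \<open>n + 1\<close> still has its old value when
  cell \<open>n\<close> is updated. The last cell keeps its value because all numbers of arrivals from the total
  capacity on yield the same revenue.\<close>

definition average_body :: "string \<Rightarrow> com" where
  "average_body arr =
     Cond (NLess (scalar ''n'') (scalar ''k''))
       (Seq
         (RSet arr (scalar ''n'')
           (RAdd (RGet arr (scalar ''n''))
             (RMul (RGet ''prob'' (NSub (scalar ''t'') (NLit 1)))
               (RSub (RGet arr (NAdd (scalar ''n'') (NLit 1))) (RGet arr (scalar ''n''))))))
         (set_scalar ''n'' (NAdd (scalar ''n'') (NLit 1))))
       (Seq (set_scalar ''n'' (NLit 0)) (set_scalar ''t'' (NSub (scalar ''t'') (NLit 1))))"

definition tabulate_init :: "string \<Rightarrow> com" where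
  "tabulate_init arr =
     Seq (set_scalar ''i'' (NLit 0))
       (Seq (set_scalar ''j'' (NLit 0)) (Seq (set_scalar ''k'' (NLit 0)) (RSet arr (NLit 0) RZero)))"

definition average_init :: com where
  "average_init = Seq (set_scalar ''n'' (NLit 0)) (set_scalar ''t'' (scalar ''horizon''))"

definition tabulate :: "string \<Rightarrow> string \<Rightarrow> com" where
  "tabulate ord arr =
     Seq (tabulate_init arr) (While (NLess (scalar ''i'') (scalar ''products'')) (tabulate_body ord arr))"

text \<open>With zero capacity the table is the single cell 0, already the answer; the guard avoids
  spending \<open>horizon I\<close> iterations when the bound contains no such term.\<close>

definition average :: "string \<Rightarrow> com" where
  "average arr =
     Cond (NLess (NLit 0) (scalar ''k''))
       (Seq average_init (While (NLess (NLit 0) (scalar ''t'')) (average_body arr)))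
       Skip"

definition evaluate :: "string \<Rightarrow> string \<Rightarrow> com" where
  "evaluate ord arr = Seq (tabulate ord arr) (average arr)"

text \<open>Without periods both revenues vanish, but a tabulation might take more than the allowed time.\<close>

definition select :: com where
  "select =
     Cond (NLess (NLit 0) (scalar ''horizon''))
       (Seq (evaluate ''order1'' ''A'')
         (Seq (evaluate ''order2'' ''B'')
           (Cond (RLess (RGet ''A'' (NLit 0)) (RGet ''B'' (NLit 0)))
             (set_scalar ''out'' (NLit 1)) Skip)))
       Skip"

text \<open>Only one ordering is mentioned, so the same facts serve both evaluations. A single bonus
  table equal to every \<open>bonus I i\<close> expresses homogeneity without
  \<open>f\<close>.\<close>

definition has_input :: "alloc \<Rightarrow> string \<Rightarrow> nat list \<Rightarrow> memory \<Rightarrow> bool" where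
  "has_input I ord \<sigma> s \<longleftrightarrow>
     fst s ''products'' 0 = products I \<and> fst s ''horizon'' 0 = horizon I \<and>
     (\<forall>i<products I. fst s ''capacity'' i = capacity I i \<and> snd s ''base'' i = base_reward I i \<and>
        snd s ''bonus'' = bonus I i) \<and>
     (\<forall>k<length \<sigma>. fst s ord k = \<sigma> ! k) \<and>
     (\<forall>t<horizon I. snd s ''prob'' t = arrival_prob I t)"

lemma has_input_cong:
  assumes "\<And>x. x \<in> {''products'', ''horizon'', ''capacity'', ord} \<Longrightarrow> fst s x = fst s' x"
    and "\<And>x. x \<in> {''base'', ''bonus'', ''prob''} \<Longrightarrow> snd s x = snd s' x"
  shows "has_input I ord \<sigma> s = has_input I ord \<sigma> s'"
  using assms by (simp add: has_input_def)

lemma has_input_nupd: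
  "x \<notin> {''products'', ''horizon'', ''capacity'', ord} \<Longrightarrow>
    has_input I ord \<sigma> (nupd x i v s) = has_input I ord \<sigma> s"
  by (rule has_input_cong) (auto simp: nupd_def)

lemma has_input_rupd:
  "x \<notin> {''base'', ''bonus'', ''prob''} \<Longrightarrow>
    has_input I ord \<sigma> (rupd x i v s) = has_input I ord \<sigma> s"
  by (rule has_input_cong) (auto simp: rupd_def)

lemma fst_nupd: "fst (nupd x i v s) = (fst s)(x := (fst s x)(i := v))"
  and snd_nupd: "snd (nupd x i v s) = snd s"
  by (simp_all add: nupd_def)

lemma fst_rupd: "fst (rupd x i v s) = fst s"
  and snd_rupd: "snd (rupd x i v s) = (snd s)(x := (snd s x)(i := v))"
  by (simp_all add: rupd_def)

lemmas memory_simps = fst_nupd snd_nupd fst_rupd snd_rupd has_input_nupd has_input_rupd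

section \<open>Correctness and cost of the tabulation\<close>

lemma fill_value_reward_Suc:
  assumes "p < length \<sigma>" and "j < capacity I (\<sigma> ! p)"
  shows "fill_value (capacity I) (reward I) \<sigma> (Suc ((\<Sum>i\<leftarrow>take p \<sigma>. capacity I i) + j)) =
    fill_value (capacity I) (reward I) \<sigma> ((\<Sum>i\<leftarrow>take p \<sigma>. capacity I i) + j) +
    base_reward I (\<sigma> ! p) + bonus I (\<sigma> ! p) (Suc j)"
proof -
  have split: "take p \<sigma> @ \<sigma> ! p # drop (Suc p) \<sigma> = \<sigma>"
    using assms(1) by (simp add: id_take_nth_drop[symmetric])
  \<comment> \<open>Products before position \<open>p\<close> are full and those after it are empty,
    so one more unit is sale \<open>Suc j\<close> of product \<open>\<sigma> ! p\<close>.\<close>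
  have "fill_value (capacity I) (reward I) \<sigma> ((\<Sum>i\<leftarrow>take p \<sigma>. capacity I i) + n) =
      (\<Sum>i\<leftarrow>take p \<sigma>. reward I i (capacity I i)) + reward I (\<sigma> ! p) n"
    if "n \<le> capacity I (\<sigma> ! p)" for n
    using fill_value_append[of "capacity I" "reward I" "take p \<sigma>" "\<sigma> ! p # drop (Suc p) \<sigma>" n]
      that fill_value_0[of "drop (Suc p) \<sigma>" "reward I" "capacity I"]
    unfolding split by (simp add: reward_0 min_absorb2)
  from this[of "Suc j"] this[of j] show ?thesis using assms(2) by (simp add: reward_Suc)
qed

text \<open>Past the last product \<open>j\<close> is forced to 0, so that on exit \<open>k\<close>
  is the total capacity.\<close>

definition tabulate_inv :: "alloc \<Rightarrow> string \<Rightarrow> nat list \<Rightarrow> string \<Rightarrow> memory \<Rightarrow> bool" where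
  "tabulate_inv I ord \<sigma> arr s \<longleftrightarrow> has_input I ord \<sigma> s \<and>
     (let p = fst s ''i'' 0; j = fst s ''j'' 0; k = fst s ''k'' 0 in
       p \<le> products I \<and> j \<le> (if p < products I then capacity I (\<sigma> ! p) else 0) \<and>
       k = (\<Sum>i\<leftarrow>take p \<sigma>. capacity I i) + j \<and>
       (\<forall>l\<le>k. snd s arr l = fill_value (capacity I) (reward I) \<sigma> l))"

text \<open>Guarantees that \<open>k\<close> is below the total capacity whenever a unit is taken,
  so the truncated difference in the loop measure really drops.\<close>

lemma sum_list_capacity_take:
  assumes "ordering I \<sigma>" and "p < products I"
  shows "(\<Sum>i\<leftarrow>take p \<sigma>. capacity I i) + capacity I (\<sigma> ! p) \<le> total_capacity I"
proof -
  have "p < length \<sigma>" using assms by (auto simp: ordering_def distinct_card[symmetric])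
  then have "(\<Sum>i\<leftarrow>take (Suc p) \<sigma>. capacity I i) = (\<Sum>i\<leftarrow>take p \<sigma>. capacity I i) + capacity I (\<sigma> ! p)"
    by (simp add: take_Suc_conv_app_nth)
  moreover have "(\<Sum>i\<leftarrow>take (Suc p) \<sigma> @ drop (Suc p) \<sigma>. capacity I i) = total_capacity I"
    unfolding append_take_drop_id total_capacity_def by (rule sum_list_ordering[OF assms(1)])
  ultimately show ?thesis unfolding map_append sum_list_append by linarith
qed

lemma length_ordering: "ordering I \<sigma> \<Longrightarrow> length \<sigma> = products I"
  by (metis card_lessThan distinct_card ordering_def)

lemma exec_tabulate:
  assumes ord: "ordering I \<sigma>" "ord \<in> {''order1'', ''order2''}" and arr: "arr \<in> {''A'', ''B''}"
    and input: "has_input I ord \<sigma> s"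
  shows "\<exists>n s'. exec (tabulate ord arr) s n s' \<and> n \<le> 100 * (products I + total_capacity I + 1) \<and>
    has_input I ord \<sigma> s' \<and> fst s' ''k'' 0 = total_capacity I \<and>
    (\<forall>l\<le>total_capacity I. snd s' arr l = fill_value (capacity I) (reward I) \<sigma> l)"
proof -
  let ?Inv = "tabulate_inv I ord \<sigma> arr"
  let ?\<mu> = "\<lambda>s :: memory. (products I - fst s ''i'' 0) + (total_capacity I - fst s ''k'' 0)"
  let ?b = "NLess (scalar ''i'') (scalar ''products'')"
  note len = length_ordering[OF ord(1)]
  have names: "ord \<noteq> ''i''" "ord \<noteq> ''j''" "ord \<noteq> ''k''"
    "arr \<noteq> ''base''" "arr \<noteq> ''bonus''" "arr \<noteq> ''prob''"
    using ord(2) arr by auto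
  have "loop_free (tabulate_init arr)" "max_cost (tabulate_init arr) \<le> 12"
    by (simp_all add: tabulate_init_def)
  then obtain n1 where n1: "exec (tabulate_init arr) s n1 (run (tabulate_init arr) s)" "n1 \<le> 12"
    using exec_loop_free[of "tabulate_init arr" s] order.trans by blast
  have init: "?Inv (run (tabulate_init arr) s)" "?\<mu> (run (tabulate_init arr) s) \<le> products I + total_capacity I"
    using input names fill_value_0[of \<sigma> "reward I" "capacity I"]
    by (auto simp: tabulate_init_def tabulate_inv_def memory_simps reward_0 Let_def)
  have step: "?Inv (run (tabulate_body ord arr) s) \<and> ?\<mu> (run (tabulate_body ord arr) s) < ?\<mu> s"
    if "?Inv s" "bval ?b s" for s
  proof -
    define p j where "p = fst s ''i'' 0" and "j = fst s ''j'' 0"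
    have input: "has_input I ord \<sigma> s"
      and k: "fst s ''k'' 0 = (\<Sum>i\<leftarrow>take p \<sigma>. capacity I i) + j"
      and table: "\<And>l. l \<le> (\<Sum>i\<leftarrow>take p \<sigma>. capacity I i) + j \<Longrightarrow>
        snd s arr l = fill_value (capacity I) (reward I) \<sigma> l"
      using that(1) unfolding tabulate_inv_def p_def j_def Let_def by auto
    have p: "p < products I"
      using that(2) input by (simp add: has_input_def p_def)
    then have j: "j \<le> capacity I (\<sigma> ! p)"
      using that(1) unfolding tabulate_inv_def p_def j_def Let_def by auto
    have "\<sigma> ! p < products I" using p len ord(1) nth_mem[of p \<sigma>] by (auto simp: ordering_def)
    then have vals: "fst s ord p = \<sigma> ! p" "fst s ''capacity'' (\<sigma> ! p) = capacity I (\<sigma> ! p)"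
      "snd s ''base'' (\<sigma> ! p) = base_reward I (\<sigma> ! p)" "snd s ''bonus'' = bonus I (\<sigma> ! p)"
      using input p len by (auto simp: has_input_def)
    have total: "(\<Sum>i\<leftarrow>take p \<sigma>. capacity I i) + capacity I (\<sigma> ! p) \<le> total_capacity I"
      by (rule sum_list_capacity_take[OF ord(1) p])
    have take: "(\<Sum>i\<leftarrow>take (Suc p) \<sigma>. capacity I i) = (\<Sum>i\<leftarrow>take p \<sigma>. capacity I i) + capacity I (\<sigma> ! p)"
      using p len by (simp add: take_Suc_conv_app_nth)
    show ?thesis
    proof (cases "j < capacity I (\<sigma> ! p)")
      case True
      note Suc = fill_value_reward_Suc[of p \<sigma> j I, OF _ True]
      show ?thesis
        using True names p input total table Suc len
        by (auto simp: tabulate_body_def tabulate_inv_def memory_simps Let_def vals k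
            p_def[symmetric] j_def[symmetric] le_Suc_eq)
    next
      case False
      then have "j = capacity I (\<sigma> ! p)" using j by simp
      then show ?thesis
        using False names p input total table
        by (auto simp: tabulate_body_def tabulate_inv_def memory_simps Let_def vals k take
            p_def[symmetric] j_def[symmetric])
    qed
  qed
  have "loop_free (tabulate_body ord arr)" by (simp add: tabulate_body_def)
  from exec_while[of _ ?Inv ?b ?\<mu>, OF this step init(1)]
  obtain n2 s' where loop: "exec (While ?b (tabulate_body ord arr)) (run (tabulate_init arr) s) n2 s'"
    "n2 \<le> (?\<mu> (run (tabulate_init arr) s) + 1) * (1 + bcost ?b + max_cost (tabulate_body ord arr))"
    "?Inv s'" "\<not> bval ?b s'"
    by blast
  have "n2 \<le> (products I + total_capacity I + 1) * (1 + bcost ?b + max_cost (tabulate_body ord arr))"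
    using init(2) by (intro order.trans[OF loop(2)] mult_le_mono1) simp
  \<comment> \<open>80 is a generous bound on one iteration; the slack up to 100 absorbs the
    initialization cost of at most 12.\<close>
  also have "\<dots> \<le> (products I + total_capacity I + 1) * 80"
    by (intro mult_le_mono2) (simp add: tabulate_body_def)
  finally have n: "n1 + n2 \<le> 100 * (products I + total_capacity I + 1)" using n1(2) by simp
  have "fst s' ''i'' 0 = products I" using loop(3,4) by (auto simp: tabulate_inv_def has_input_def Let_def)
  then have "has_input I ord \<sigma> s'" "fst s' ''k'' 0 = total_capacity I"
    "\<forall>l\<le>total_capacity I. snd s' arr l = fill_value (capacity I) (reward I) \<sigma> l"
    using loop(3) len sum_list_ordering[OF ord(1), of "capacity I"]
    by (auto simp: tabulate_inv_def Let_def total_capacity_def)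
  with n exec.Seq[OF n1(1) loop(1)] show ?thesis unfolding tabulate_def by blast
qed

section \<open>Correctness and cost of the averaging\<close>

text \<open>\<open>h\<close> is the table before the current sweep, extended constantly beyond
  \<open>C\<close>: cells below \<open>n\<close> are already averaged over period
  \<open>t - 1\<close>, the others still hold \<open>h\<close>. The target \<open>v\<close> is
  preserved. As \<open>t = 0\<close> forces \<open>n = 0\<close>, cell 0 finally holds
  \<open>h 0 = v\<close>.\<close>

definition average_inv :: "alloc \<Rightarrow> real \<Rightarrow> string \<Rightarrow> memory \<Rightarrow> bool" where
  "average_inv I v arr s \<longleftrightarrow>
     (let t = fst s ''t'' 0; n = fst s ''n'' 0; C = total_capacity I in
       fst s ''k'' 0 = C \<and> (\<forall>t<horizon I. snd s ''prob'' t = arrival_prob I t) \<and>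
       t \<le> horizon I \<and> n \<le> C \<and> (t = 0 \<longrightarrow> n = 0) \<and>
       (\<exists>h. (\<forall>l\<ge>C. h l = h C) \<and> arrival_mean (arrival_prob I) t h = v \<and>
         (\<forall>l<n. snd s arr l = h l + arrival_prob I (t - 1) * (h (Suc l) - h l)) \<and>
         (\<forall>l\<in>{n..C}. snd s arr l = h l)))"

lemma arrival_mean_const: "(\<And>l. h l = h 0) \<Longrightarrow> arrival_mean p t h = h 0"
proof (induction t arbitrary: h)
  case (Suc t)
  have "h l + p t * (h (Suc l) - h l) = h 0" for l
    using Suc.prems[of l] Suc.prems[of "Suc l"] by simp
  then show ?case using Suc.IH[of "\<lambda>_. h 0"] by simp
qed simp

lemma exec_average:
  assumes arr: "arr \<in> {''A'', ''B''}" and k: "fst s ''k'' 0 = total_capacity I"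
    and horizon: "fst s ''horizon'' 0 = horizon I"
    and prob: "\<And>t. t < horizon I \<Longrightarrow> snd s ''prob'' t = arrival_prob I t"
    and sat: "\<And>l. total_capacity I \<le> l \<Longrightarrow> h l = h (total_capacity I)"
    and table: "\<And>l. l \<le> total_capacity I \<Longrightarrow> snd s arr l = h l"
  shows "\<exists>n s'. exec (average arr) s n s' \<and> n \<le> 200 * (horizon I * total_capacity I + 1) \<and>
    snd s' arr 0 = arrival_mean (arrival_prob I) (horizon I) h"
proof (cases "total_capacity I = 0")
  case True
  then have "h l = h 0" for l using sat[of l] by simp
  then have "snd s arr 0 = arrival_mean (arrival_prob I) (horizon I) h"
    using table[of 0] by (simp add: arrival_mean_const)
  moreover have "exec (average arr) s (1 + bcost (NLess (NLit 0) (scalar ''k'')) + 1) s"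
    unfolding average_def using k True by (intro exec.CondFalse exec.Skip) simp
  ultimately show ?thesis by (intro exI conjI) auto
next
  case False
  define v where "v = arrival_mean (arrival_prob I) (horizon I) h"
  let ?C = "total_capacity I"
  let ?Inv = "average_inv I v arr"
  \<comment> \<open>A sweep takes \<open>?C\<close> updates and one reset. Since
    \<open>n \<le> ?C\<close>, the difference is not truncated while \<open>t\<close> is
    positive.\<close>
  let ?\<mu> = "\<lambda>s :: memory. fst s ''t'' 0 * (?C + 1) - fst s ''n'' 0"
  let ?b = "NLess (NLit 0) (scalar ''t'')"
  have names: "arr \<noteq> ''prob''" using arr by auto
  obtain n1 where n1: "exec average_init s n1 (run average_init s)" "n1 \<le> 10"
    using exec_loop_free[of average_init s] by (auto simp: average_init_def)
  have init: "?Inv (run average_init s)" "?\<mu> (run average_init s) = horizon I * (?C + 1)"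
    using k horizon prob sat table
    by (auto simp: average_init_def average_inv_def memory_simps Let_def v_def)
  have step: "?Inv (run (average_body arr) s) \<and> ?\<mu> (run (average_body arr) s) < ?\<mu> s"
    if inv: "?Inv s" and test: "bval ?b s" for s
  proof -
    define n where "n = fst s ''n'' 0"
    obtain t where t: "fst s ''t'' 0 = Suc t" using test by (cases "fst s ''t'' 0") auto
    obtain h where k: "fst s ''k'' 0 = ?C"
      and prob: "\<forall>t<horizon I. snd s ''prob'' t = arrival_prob I t"
      and bounds: "t < horizon I" "n \<le> ?C"
      and h: "\<forall>l\<ge>?C. h l = h ?C" "arrival_mean (arrival_prob I) (Suc t) h = v"
        "\<forall>l<n. snd s arr l = h l + arrival_prob I t * (h (Suc l) - h l)"
        "\<forall>l\<in>{n..?C}. snd s arr l = h l"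
      using inv t unfolding average_inv_def n_def[symmetric] Let_def by auto
    let ?s = "run (average_body arr) s" and ?h = "\<lambda>l. h l + arrival_prob I t * (h (Suc l) - h l)"
    show ?thesis
    proof (cases "n < ?C")
      case True
      then have "snd s arr n = h n" "snd s arr (Suc n) = h (Suc n)" using h(4) by auto
      then have s': "fst ?s ''k'' 0 = ?C" "fst ?s ''t'' 0 = Suc t" "fst ?s ''n'' 0 = Suc n"
        "snd ?s ''prob'' = snd s ''prob''" "snd ?s arr = (snd s arr)(n := ?h n)"
        using True names k t prob bounds(1)
        by (simp_all add: average_body_def memory_simps n_def[symmetric])
      have table: "\<forall>l<Suc n. snd ?s arr l = ?h l" "\<forall>l\<in>{Suc n..?C}. snd ?s arr l = h l"
        using h(3,4) by (simp_all add: s' less_Suc_eq)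
      have "?Inv ?s"
        unfolding average_inv_def Let_def s'(1-4) using True prob bounds table h(2)
        by (intro conjI exI[of _ h] h(1)) simp_all
      moreover have "Suc t * (?C + 1) - Suc n < Suc t * (?C + 1) - n" using True by auto
      ultimately show ?thesis unfolding s' t n_def[symmetric] by blast
    next
      case False
      then have n: "n = ?C" using bounds by simp
      have s': "fst ?s ''k'' 0 = ?C" "fst ?s ''t'' 0 = t" "fst ?s ''n'' 0 = 0" "snd ?s = snd s"
        using n k t by (simp_all add: average_body_def memory_simps n_def[symmetric])
      \<comment> \<open>The untouched last cell is right because the increment of \<open>h\<close>
        at \<open>?C\<close> vanishes. The table now holds \<open>?h\<close>, the next witness, with
        the same mean by the recursion of \<open>arrival_mean\<close>.\<close>
      have "h (Suc ?C) = h ?C" using h(1) le_SucI by blast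
      then have table: "\<forall>l\<in>{0..?C}. snd s arr l = ?h l"
        using h(3,4) by (auto simp: n le_less)
      have const: "\<forall>l\<ge>?C. ?h l = ?h ?C"
      proof (intro allI impI)
        fix l assume "?C \<le> l"
        then have "h l = h ?C" "h (Suc l) = h ?C" "h (Suc ?C) = h ?C"
          using h(1) le_SucI by blast+
        then show "?h l = ?h ?C" by simp
      qed
      have "?Inv ?s"
        unfolding average_inv_def Let_def s' using prob bounds table h(2)
        by (intro conjI exI[of _ ?h] const) simp_all
      moreover have "t * (?C + 1) < Suc t * (?C + 1) - n" using n by simp
      ultimately show ?thesis unfolding s' t n_def[symmetric] by simp
    qed
  qed
  have "loop_free (average_body arr)" by (simp add: average_body_def)
  from exec_while[of _ ?Inv ?b ?\<mu>, OF this step init(1)]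
  obtain n2 s' where loop: "exec (While ?b (average_body arr)) (run average_init s) n2 s'"
    "n2 \<le> (?\<mu> (run average_init s) + 1) * (1 + bcost ?b + max_cost (average_body arr))"
    "?Inv s'" "\<not> bval ?b s'"
    by blast
  have "n2 \<le> (horizon I * (?C + 1) + 1) * 60"
    using loop(2) unfolding init(2)
    by (rule order.trans) (intro mult_le_mono2, simp add: average_body_def)
  \<comment> \<open>Positive capacity gives \<open>?C + 1 \<le> 2 * ?C\<close>, which removes the
    separate term in \<open>horizon I\<close>.\<close>
  also have "\<dots> \<le> (horizon I * (2 * ?C) + 1) * 60"
    using False by (intro mult_le_mono1 add_le_mono1 mult_le_mono2) simp
  finally have n2: "n2 \<le> 120 * (horizon I * ?C) + 60" by simp
  have "exec (average arr) s (1 + bcost (NLess (NLit 0) (scalar ''k'')) + (n1 + n2)) s'"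
    unfolding average_def using k False
    by (intro exec.CondTrue exec.Seq[OF n1(1) loop(1)]) simp
  moreover have "snd s' arr 0 = v" using loop(3,4) by (auto simp: average_inv_def Let_def)
  ultimately show ?thesis unfolding v_def[symmetric] using n1(2) n2
    by (intro exI conjI) auto
qed

section \<open>Correctness and cost of the selection\<close>

lemma exec_evaluate:
  assumes valid: "valid_alloc I" and ord: "ordering I \<sigma>" "ord \<in> {''order1'', ''order2''}"
    and arr: "arr \<in> {''A'', ''B''}" and input: "has_input I ord \<sigma> s"
  shows "\<exists>n s'. exec (evaluate ord arr) s n s' \<and>
    n \<le> 300 * (products I + total_capacity I + horizon I * total_capacity I + 1) \<and>
    snd s' arr 0 = expected_revenue I (fill I \<sigma>)"
proof -
  obtain n s' where s': "exec (tabulate ord arr) s n s'"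
    "n \<le> 100 * (products I + total_capacity I + 1)" "has_input I ord \<sigma> s'"
    "fst s' ''k'' 0 = total_capacity I"
    "\<And>l. l \<le> total_capacity I \<Longrightarrow> snd s' arr l = fill_value (capacity I) (reward I) \<sigma> l"
    using exec_tabulate[OF ord arr input] by blast
  have sat: "fill_value (capacity I) (reward I) \<sigma> l =
      fill_value (capacity I) (reward I) \<sigma> (total_capacity I)" if "total_capacity I \<le> l" for l
    using that sum_list_ordering[OF ord(1), of "capacity I"]
    by (simp add: fill_value_saturated total_capacity_def)
  obtain n' s'' where s'': "exec (average arr) s' n' s''"
    "n' \<le> 200 * (horizon I * total_capacity I + 1)"
    "snd s'' arr 0 = expected_revenue I (fill I \<sigma>)"
    using exec_average[of arr s' I, OF arr s'(4) _ _ sat s'(5)] s'(3)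
    by (auto simp: has_input_def expected_revenue_fill valid ord)
  from exec.Seq[OF s'(1) s''(1)] s'(2) s''(2,3) show ?thesis
    unfolding evaluate_def by (intro exI conjI) auto
qed

lemma writes_evaluate:
  "nwrites (evaluate ord arr) = {''i'', ''j'', ''k'', ''n'', ''t''}" "rwrites (evaluate ord arr) = {arr}"
  by (auto simp: evaluate_def tabulate_def average_def tabulate_init_def tabulate_body_def
      average_init_def average_body_def)

lemma has_input_encode:
  assumes "homogeneous I f" and "ordering I \<sigma>" and "ordering I \<tau>"
  shows "has_input I ''order1'' \<sigma> (encode I f \<sigma> \<tau>)" "has_input I ''order2'' \<tau> (encode I f \<sigma> \<tau>)"
  using assms by (auto simp: has_input_def encode_def homogeneous_def)

text \<open>Every product with positive capacity contributes at least 1 to the total; the remaining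
  ones account for the middle summand of \<open>time_bound\<close>.\<close>

lemma products_le: "products I \<le> card {i. i < products I \<and> capacity I i = 0} + total_capacity I"
proof -
  let ?Z = "{i. i < products I \<and> capacity I i = 0}" and ?P = "{i. i < products I \<and> 0 < capacity I i}"
  have "products I = card (?Z \<union> ?P)"
    by (subst card_lessThan[symmetric], intro arg_cong[where f = card]) auto
  also have "\<dots> \<le> card ?Z + card ?P" by (rule card_Un_le)
  also have "card ?P \<le> (\<Sum>i\<in>?P. capacity I i)"
    using sum_mono[of ?P "\<lambda>_. 1" "capacity I"] by simp
  also have "\<dots> \<le> total_capacity I"
    unfolding total_capacity_def by (intro sum_mono2) auto
  finally show ?thesis by simp
qed

lemma exec_select:
  assumes valid: "valid_alloc I" and hom: "homogeneous I f"
    and ord: "ordering I \<sigma>" "ordering I \<tau>"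
  shows "\<exists>n s. exec select (encode I f \<sigma> \<tau>) n s \<and> n \<le> 2000 * time_bound I \<and>
    expected_revenue I (fill I (selected s \<sigma> \<tau>)) =
      max (expected_revenue I (fill I \<sigma>)) (expected_revenue I (fill I \<tau>))"
proof (cases "horizon I = 0")
  case True
  let ?s = "encode I f \<sigma> \<tau>" and ?b = "NLess (NLit 0) (scalar ''horizon'')"
  have "exec select ?s (1 + bcost ?b + 1) ?s"
    unfolding select_def using True by (intro exec.CondFalse exec.Skip) (simp add: encode_def)
  moreover have "1 + bcost ?b + 1 \<le> 2000 * time_bound I" by (simp add: time_bound_def)
  \<comment> \<open>Both orderings earn 0, so the default choice in \<open>out\<close> is
    correct.\<close>
  moreover have "expected_revenue I \<pi> = 0" for \<pi>
    using True by (simp add: expected_revenue_def revenue_def[abs_def])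
  ultimately show ?thesis by (intro exI conjI) auto
next
  case False
  let ?s = "encode I f \<sigma> \<tau>" and ?b = "NLess (NLit 0) (scalar ''horizon'')"
  let ?N = "products I + total_capacity I + horizon I * total_capacity I + 1"
  let ?c = "Cond (RLess (RGet ''A'' (NLit 0)) (RGet ''B'' (NLit 0))) (set_scalar ''out'' (NLit 1)) Skip"
  note input = has_input_encode[OF hom ord]
  obtain n1 s1 where s1: "exec (evaluate ''order1'' ''A'') ?s n1 s1" "n1 \<le> 300 * ?N"
    "snd s1 ''A'' 0 = expected_revenue I (fill I \<sigma>)"
    using exec_evaluate[OF valid ord(1) _ _ input(1), of "''A''"] by auto
  \<comment> \<open>The first evaluation writes only work variables and \<open>A\<close>, so the
    encoded input survives.\<close>
  have "has_input I ''order2'' \<tau> s1"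
    using input(2)
    by (subst has_input_cong[of _ s1 ?s]) (auto simp: exec_frame[OF s1(1)] writes_evaluate)
  then obtain n2 s2 where s2: "exec (evaluate ''order2'' ''B'') s1 n2 s2" "n2 \<le> 300 * ?N"
    "snd s2 ''B'' 0 = expected_revenue I (fill I \<tau>)"
    using exec_evaluate[OF valid ord(2) _ _, of "''order2''" "''B''" s1] by auto
  have A: "snd s2 ''A'' 0 = expected_revenue I (fill I \<sigma>)"
    using exec_frame(2)[OF s2(1), of "''A''"] s1(3) by (simp add: writes_evaluate)
  have out: "fst s2 ''out'' 0 = 0"
    using exec_frame(1)[OF s1(1), of "''out''"] exec_frame(1)[OF s2(1), of "''out''"]
    by (simp add: writes_evaluate encode_def)
  obtain n3 where n3: "exec ?c s2 n3 (run ?c s2)" "n3 \<le> 20"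
    using exec_loop_free[of ?c s2] by auto
  have "exec select ?s (1 + bcost ?b + (n1 + (n2 + n3))) (run ?c s2)"
    unfolding select_def using False
    by (intro exec.CondTrue exec.Seq[OF s1(1) exec.Seq[OF s2(1) n3(1)]]) (simp add: encode_def)
  moreover have "1 + bcost ?b + (n1 + (n2 + n3)) \<le> 2000 * time_bound I"
  proof -
    have "total_capacity I \<le> horizon I * total_capacity I" using False by simp
    \<comment> \<open>Here \<open>p\<close> counts products, \<open>c\<close> is the total capacity,
      \<open>d\<close> its product with the horizon and \<open>z\<close> the number of products
      without capacity. The two evaluations then cost at most \<open>2 * 300 * 3 = 1800\<close>
      times \<open>time_bound I\<close>, and 2000 leaves room for the tests.\<close>
    moreover have "p + c + d + 1 \<le> 3 * (d + z + 1)" if "c \<le> d" "p \<le> z + c" for p c d z :: nat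
      using that by simp
    ultimately have "?N \<le> 3 * time_bound I" using products_le[of I] unfolding time_bound_def by blast
    moreover have "1 \<le> time_bound I" by (simp add: time_bound_def)
    ultimately show ?thesis using s1(2) s2(2) n3(2) by simp
  qed
  moreover have "expected_revenue I (fill I (selected (run ?c s2) \<sigma> \<tau>)) =
      max (expected_revenue I (fill I \<sigma>)) (expected_revenue I (fill I \<tau>))"
    using A s2(3) out by (auto simp: selected_def memory_simps)
  ultimately show ?thesis by blast
qed

theorem theorem1:
  shows "(\<exists>P K. \<forall>I f \<sigma> \<tau>.
            valid_alloc I \<and> homogeneous I f \<and> base_ordering I \<sigma> \<and> cap_ordering I \<tau> \<longrightarrow>
              (\<exists>n s. exec P (encode I f \<sigma> \<tau>) n s \<and> n \<le> K * time_bound I \<and>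
                 expected_revenue I (fill I (selected s \<sigma> \<tau>)) =
                   max (expected_revenue I (fill I \<sigma>)) (expected_revenue I (fill I \<tau>))))
       \<and> (\<forall>I f \<sigma> \<tau>.
            valid_alloc I \<and> homogeneous I f \<and> base_ordering I \<sigma> \<and> cap_ordering I \<tau> \<longrightarrow>
              max (expected_revenue I (fill I \<sigma>)) (expected_revenue I (fill I \<tau>))
                \<ge> 1 / 2 * expected_offline I)"
proof (rule conjI)
  show "\<exists>P K. \<forall>I f \<sigma> \<tau>.
      valid_alloc I \<and> homogeneous I f \<and> base_ordering I \<sigma> \<and> cap_ordering I \<tau> \<longrightarrow>
        (\<exists>n s. exec P (encode I f \<sigma> \<tau>) n s \<and> n \<le> K * time_bound I \<and>
           expected_revenue I (fill I (selected s \<sigma> \<tau>)) =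
             max (expected_revenue I (fill I \<sigma>)) (expected_revenue I (fill I \<tau>)))"
    using exec_select unfolding base_ordering_def cap_ordering_def by blast
  show "\<forall>I f \<sigma> \<tau>.
      valid_alloc I \<and> homogeneous I f \<and> base_ordering I \<sigma> \<and> cap_ordering I \<tau> \<longrightarrow>
        max (expected_revenue I (fill I \<sigma>)) (expected_revenue I (fill I \<tau>))
          \<ge> 1 / 2 * expected_offline I"
  proof (intro allI impI, elim conjE)
    fix I f \<sigma> \<tau>
    assume "valid_alloc I" "homogeneous I f" "base_ordering I \<sigma>" "cap_ordering I \<tau>"
    from expected_offline_le[OF this]
    show "1 / 2 * expected_offline I \<le>
        max (expected_revenue I (fill I \<sigma>)) (expected_revenue I (fill I \<tau>))"
      by (simp add: max_def)
  qed
qed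

end
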